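(* For every integer $n > 1$, an $n$-ladder $L$ is maximal if and only if there is no cofinal meet-subsemilattice $C \subseteq L$ such that $C$ is an $(n-1)$-ladder in the order induced from $L$.
   Context: A poset is lower finite if for each element $p$ the set $\{q : q \le p\}$ is finite. In a poset, $q$ is a lower cover of $p$ if $q < p$ and there is no $x$ with $q < x < p$. For a positive integer $n$, an $n$-ladder is a lower finite lattice in which every element has at most $n$ lower covers. An ideal of a poset is a nonempty subset that is downward closed and upward directed; it is proper if it is not the whole poset. An $n$-ladder is maximal if it is not isomorphic to a proper ideal of an $n$-ladder. A meet-subsemilattice of a meet-semilattice $P$ is a nonempty subset closed under the binary meets of $P$. A subset $C \subseteq L$ is cofinal if every element of $L$ is below some element of $C$. *)

theory Defs
  imports "HOL-Algebra.Lattice" "HOL-Library.Equipollence"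
begin

text \<open>
  Posets are the structures of \<^theory>\<open>HOL-Algebra.Order\<close>, with an explicit carrier; a subset
  \<open>C\<close> of the carrier of \<open>L\<close> with the induced order is \<open>L\<lparr>carrier := C\<rparr>\<close>.
\<close>

definition lower_finite :: "('a, 'm) gorder_scheme \<Rightarrow> bool" where
  "lower_finite P \<longleftrightarrow> (\<forall>p \<in> carrier P. finite {q \<in> carrier P. q \<sqsubseteq>\<^bsub>P\<^esub> p})"

definition lower_cover :: "('a, 'm) gorder_scheme \<Rightarrow> 'a \<Rightarrow> 'a \<Rightarrow> bool" where
  "lower_cover P q p \<longleftrightarrow>
     q \<in> carrier P \<and> p \<in> carrier P \<and> q \<sqsubset>\<^bsub>P\<^esub> p \<and>
     \<not> (\<exists>x \<in> carrier P. q \<sqsubset>\<^bsub>P\<^esub> x \<and> x \<sqsubset>\<^bsub>P\<^esub> p)"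

text \<open>Lower finiteness makes the set of lower covers finite, so \<^const>\<open>card\<close> really counts it.\<close>

definition n_ladder :: "nat \<Rightarrow> ('a, 'm) gorder_scheme \<Rightarrow> bool" where
  "n_ladder n L \<longleftrightarrow>
     lattice L \<and> lower_finite L \<and> (\<forall>p \<in> carrier L. card {q. lower_cover L q p} \<le> n)"

definition order_ideal :: "'a set \<Rightarrow> ('a, 'm) gorder_scheme \<Rightarrow> bool" where
  "order_ideal I P \<longleftrightarrow>
     I \<subseteq> carrier P \<and> I \<noteq> {} \<and>
     (\<forall>x \<in> I. \<forall>y \<in> carrier P. y \<sqsubseteq>\<^bsub>P\<^esub> x \<longrightarrow> y \<in> I) \<and>
     (\<forall>x \<in> I. \<forall>y \<in> I. \<exists>z \<in> I. x \<sqsubseteq>\<^bsub>P\<^esub> z \<and> y \<sqsubseteq>\<^bsub>P\<^esub> z)"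

definition order_isomorphic :: "('a, 'm) gorder_scheme \<Rightarrow> ('b, 'k) gorder_scheme \<Rightarrow> bool" where
  "order_isomorphic P Q \<longleftrightarrow> (\<exists>f. bij_betw f (carrier P) (carrier Q) \<and> order_emb P Q f)"

text \<open>
  A HOL definition cannot quantify over types, so the type \<open>'b\<close> holding the elements of the
  larger ladders is a parameter of maximality. The lemma \<open>maximal_ladder_any_type\<close> below shows
  that the choice is immaterial once \<open>'b\<close> is infinite and at least as large as \<open>L\<close>: maximality
  with respect to such a type implies maximality with respect to every type.
\<close>

definition maximal_ladder :: "'b itself \<Rightarrow> nat \<Rightarrow> ('a, 'm) gorder_scheme \<Rightarrow> bool" where
  "maximal_ladder (T :: 'b itself) n L \<longleftrightarrow>
     n_ladder n L \<and>
     \<not> (\<exists>(M :: 'b gorder) I. n_ladder n M \<and> order_ideal I M \<and> I \<noteq> carrier M \<and>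
          order_isomorphic L (M\<lparr>carrier := I\<rparr>))"

definition meet_subsemilattice :: "'a set \<Rightarrow> ('a, 'm) gorder_scheme \<Rightarrow> bool" where
  "meet_subsemilattice C P \<longleftrightarrow>
     C \<subseteq> carrier P \<and> C \<noteq> {} \<and> (\<forall>x \<in> C. \<forall>y \<in> C. x \<sqinter>\<^bsub>P\<^esub> y \<in> C)"

definition cofinal_in :: "'a set \<Rightarrow> ('a, 'm) gorder_scheme \<Rightarrow> bool" where
  "cofinal_in C P \<longleftrightarrow> C \<subseteq> carrier P \<and> (\<forall>x \<in> carrier P. \<exists>c \<in> C. x \<sqsubseteq>\<^bsub>P\<^esub> c)"


lemma ladder_facts:
  assumes "n_ladder n M"
  shows ladder_lattice: "lattice M"
    and ladder_eq: "eq M = (=)"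
    and ladder_refl: "x \<in> carrier M \<Longrightarrow> x \<sqsubseteq>\<^bsub>M\<^esub> x"
    and ladder_antisym: "x \<sqsubseteq>\<^bsub>M\<^esub> y \<Longrightarrow> y \<sqsubseteq>\<^bsub>M\<^esub> x \<Longrightarrow> x \<in> carrier M \<Longrightarrow> y \<in> carrier M \<Longrightarrow> x = y"
    and ladder_trans: "x \<sqsubseteq>\<^bsub>M\<^esub> y \<Longrightarrow> y \<sqsubseteq>\<^bsub>M\<^esub> z \<Longrightarrow>
      x \<in> carrier M \<Longrightarrow> y \<in> carrier M \<Longrightarrow> z \<in> carrier M \<Longrightarrow> x \<sqsubseteq>\<^bsub>M\<^esub> z"
    and ladder_join_closed: "x \<in> carrier M \<Longrightarrow> y \<in> carrier M \<Longrightarrow> x \<squnion>\<^bsub>M\<^esub> y \<in> carrier M"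
    and ladder_join_left: "x \<in> carrier M \<Longrightarrow> y \<in> carrier M \<Longrightarrow> x \<sqsubseteq>\<^bsub>M\<^esub> x \<squnion>\<^bsub>M\<^esub> y"
    and ladder_join_right: "x \<in> carrier M \<Longrightarrow> y \<in> carrier M \<Longrightarrow> y \<sqsubseteq>\<^bsub>M\<^esub> x \<squnion>\<^bsub>M\<^esub> y"
    and ladder_join_le: "x \<sqsubseteq>\<^bsub>M\<^esub> z \<Longrightarrow> y \<sqsubseteq>\<^bsub>M\<^esub> z \<Longrightarrow>
      x \<in> carrier M \<Longrightarrow> y \<in> carrier M \<Longrightarrow> z \<in> carrier M \<Longrightarrow> x \<squnion>\<^bsub>M\<^esub> y \<sqsubseteq>\<^bsub>M\<^esub> z"
    and ladder_meet_closed: "x \<in> carrier M \<Longrightarrow> y \<in> carrier M \<Longrightarrow> x \<sqinter>\<^bsub>M\<^esub> y \<in> carrier M"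
    and ladder_meet_left: "x \<in> carrier M \<Longrightarrow> y \<in> carrier M \<Longrightarrow> x \<sqinter>\<^bsub>M\<^esub> y \<sqsubseteq>\<^bsub>M\<^esub> x"
    and ladder_meet_right: "x \<in> carrier M \<Longrightarrow> y \<in> carrier M \<Longrightarrow> x \<sqinter>\<^bsub>M\<^esub> y \<sqsubseteq>\<^bsub>M\<^esub> y"
    and ladder_meet_le: "z \<sqsubseteq>\<^bsub>M\<^esub> x \<Longrightarrow> z \<sqsubseteq>\<^bsub>M\<^esub> y \<Longrightarrow>
      x \<in> carrier M \<Longrightarrow> y \<in> carrier M \<Longrightarrow> z \<in> carrier M \<Longrightarrow> z \<sqsubseteq>\<^bsub>M\<^esub> x \<sqinter>\<^bsub>M\<^esub> y"
    and ladder_finite: "x \<in> carrier M \<Longrightarrow> finite {q \<in> carrier M. q \<sqsubseteq>\<^bsub>M\<^esub> x}"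
proof -
  show M: "lattice M" using assms by (simp add: n_ladder_def)
  interpret M: lattice M by (rule M)
  show "eq M = (=)" by (rule M.eq_is_equal)
  show "x \<in> carrier M \<Longrightarrow> x \<sqsubseteq>\<^bsub>M\<^esub> x" by (rule M.le_refl)
  show "x \<sqsubseteq>\<^bsub>M\<^esub> y \<Longrightarrow> y \<sqsubseteq>\<^bsub>M\<^esub> x \<Longrightarrow> x \<in> carrier M \<Longrightarrow> y \<in> carrier M \<Longrightarrow> x = y"
    by (rule M.le_antisym)
  show "x \<sqsubseteq>\<^bsub>M\<^esub> y \<Longrightarrow> y \<sqsubseteq>\<^bsub>M\<^esub> z \<Longrightarrow>
      x \<in> carrier M \<Longrightarrow> y \<in> carrier M \<Longrightarrow> z \<in> carrier M \<Longrightarrow> x \<sqsubseteq>\<^bsub>M\<^esub> z" by (rule M.le_trans)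
  show "x \<in> carrier M \<Longrightarrow> y \<in> carrier M \<Longrightarrow> x \<squnion>\<^bsub>M\<^esub> y \<in> carrier M" by (rule M.join_closed)
  show "x \<in> carrier M \<Longrightarrow> y \<in> carrier M \<Longrightarrow> x \<sqsubseteq>\<^bsub>M\<^esub> x \<squnion>\<^bsub>M\<^esub> y" by (rule M.join_left)
  show "x \<in> carrier M \<Longrightarrow> y \<in> carrier M \<Longrightarrow> y \<sqsubseteq>\<^bsub>M\<^esub> x \<squnion>\<^bsub>M\<^esub> y" by (rule M.join_right)
  show "x \<sqsubseteq>\<^bsub>M\<^esub> z \<Longrightarrow> y \<sqsubseteq>\<^bsub>M\<^esub> z \<Longrightarrow>
      x \<in> carrier M \<Longrightarrow> y \<in> carrier M \<Longrightarrow> z \<in> carrier M \<Longrightarrow> x \<squnion>\<^bsub>M\<^esub> y \<sqsubseteq>\<^bsub>M\<^esub> z" by (rule M.join_le)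
  show "x \<in> carrier M \<Longrightarrow> y \<in> carrier M \<Longrightarrow> x \<sqinter>\<^bsub>M\<^esub> y \<in> carrier M" by (rule M.meet_closed)
  show "x \<in> carrier M \<Longrightarrow> y \<in> carrier M \<Longrightarrow> x \<sqinter>\<^bsub>M\<^esub> y \<sqsubseteq>\<^bsub>M\<^esub> x" by (rule M.meet_left)
  show "x \<in> carrier M \<Longrightarrow> y \<in> carrier M \<Longrightarrow> x \<sqinter>\<^bsub>M\<^esub> y \<sqsubseteq>\<^bsub>M\<^esub> y" by (rule M.meet_right)
  show "z \<sqsubseteq>\<^bsub>M\<^esub> x \<Longrightarrow> z \<sqsubseteq>\<^bsub>M\<^esub> y \<Longrightarrow>
      x \<in> carrier M \<Longrightarrow> y \<in> carrier M \<Longrightarrow> z \<in> carrier M \<Longrightarrow> z \<sqsubseteq>\<^bsub>M\<^esub> x \<sqinter>\<^bsub>M\<^esub> y" by (rule M.meet_le)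
  show "x \<in> carrier M \<Longrightarrow> finite {q \<in> carrier M. q \<sqsubseteq>\<^bsub>M\<^esub> x}"
    using assms by (simp add: n_ladder_def lower_finite_def)
qed

lemma n_ladder_pullback:
  fixes M :: "('c, 'm) gorder_scheme" and A :: "'b set" and h :: "'b \<Rightarrow> 'c"
  assumes M: "n_ladder n M" and J: "order_ideal J M" and h: "bij_betw h A J"
  shows "n_ladder n \<lparr>carrier = A, eq = (=), le = (\<lambda>x y. h x \<sqsubseteq>\<^bsub>M\<^esub> h y)\<rparr>" (is "n_ladder n ?N")
proof -
  note le_antisym = ladder_antisym[OF M] and le_trans = ladder_trans[OF M]
    and join_closed = ladder_join_closed[OF M] and join_left = ladder_join_left[OF M]
    and join_right = ladder_join_right[OF M] and join_le = ladder_join_le[OF M]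
    and meet_closed = ladder_meet_closed[OF M] and meet_left = ladder_meet_left[OF M]
    and meet_right = ladder_meet_right[OF M] and meet_le = ladder_meet_le[OF M]
    and lfM = ladder_finite[OF M]
  have JM: "J \<subseteq> carrier M"
    and down: "\<And>x y. x \<in> J \<Longrightarrow> y \<in> carrier M \<Longrightarrow> y \<sqsubseteq>\<^bsub>M\<^esub> x \<Longrightarrow> y \<in> J"
    and dir: "\<And>x y. x \<in> J \<Longrightarrow> y \<in> J \<Longrightarrow> \<exists>z \<in> J. x \<sqsubseteq>\<^bsub>M\<^esub> z \<and> y \<sqsubseteq>\<^bsub>M\<^esub> z"
    using J by (auto simp: order_ideal_def)
  have inj: "inj_on h A" and im: "h ` A = J" using h by (auto simp: bij_betw_def)
  have hJ: "h x \<in> J" and hM: "h x \<in> carrier M" if "x \<in> A" for x using that im JM by auto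
  have joinJ: "x \<squnion>\<^bsub>M\<^esub> y \<in> J" if xy: "x \<in> J" "y \<in> J" for x y
  proof -
    obtain z where z: "z \<in> J" "x \<sqsubseteq>\<^bsub>M\<^esub> z" "y \<sqsubseteq>\<^bsub>M\<^esub> z" using dir xy by blast
    have "x \<squnion>\<^bsub>M\<^esub> y \<sqsubseteq>\<^bsub>M\<^esub> z" using z xy JM by (intro join_le) auto
    moreover have "x \<squnion>\<^bsub>M\<^esub> y \<in> carrier M" using xy JM by (intro join_closed) auto
    ultimately show ?thesis using down[OF z(1)] by simp
  qed
  have meetJ: "x \<sqinter>\<^bsub>M\<^esub> y \<in> J" if xy: "x \<in> J" "y \<in> J" for x y
  proof -
    have M: "x \<in> carrier M" "y \<in> carrier M" using xy JM by auto
    show ?thesis by (rule down[OF xy(1) meet_closed[OF M] meet_left[OF M]])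
  qed
  have po: "partial_order ?N"
  proof
    fix x y assume "x \<sqsubseteq>\<^bsub>?N\<^esub> y" "y \<sqsubseteq>\<^bsub>?N\<^esub> x" "x \<in> carrier ?N" "y \<in> carrier ?N"
    then have "h x = h y" "x \<in> A" "y \<in> A" using le_antisym hM by auto
    then show "x .=\<^bsub>?N\<^esub> y" using inj by (auto dest: inj_onD)
  next
    fix x y z
    assume "x \<sqsubseteq>\<^bsub>?N\<^esub> y" "y \<sqsubseteq>\<^bsub>?N\<^esub> z" "x \<in> carrier ?N" "y \<in> carrier ?N" "z \<in> carrier ?N"
    then show "x \<sqsubseteq>\<^bsub>?N\<^esub> z" using le_trans[of "h x" "h y" "h z"] hM by simp
  qed (simp_all add: hM ladder_refl[OF M])
  interpret N: partial_order ?N by (rule po)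
  have lat: "lattice ?N"
  proof
    fix x y assume "x \<in> carrier ?N" "y \<in> carrier ?N"
    then have xy: "x \<in> A" "y \<in> A" by auto
    obtain s where s: "s \<in> A" "h s = h x \<squnion>\<^bsub>M\<^esub> h y" using joinJ[OF hJ hJ, OF xy] im by auto
    have "least ?N s (Upper ?N {x, y})"
      using s xy join_left join_right join_le hM
      by (auto simp: least_def Upper_def)
    then show "\<exists>s. least ?N s (Upper ?N {x, y})" ..
    obtain t where t: "t \<in> A" "h t = h x \<sqinter>\<^bsub>M\<^esub> h y" using meetJ[OF hJ hJ, OF xy] im by auto
    have "greatest ?N t (Lower ?N {x, y})"
      using t xy meet_left meet_right meet_le hM
      by (auto simp: greatest_def Lower_def)
    then show "\<exists>s. greatest ?N s (Lower ?N {x, y})" ..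
  qed
  have lf: "lower_finite ?N"
    unfolding lower_finite_def
  proof
    fix p assume "p \<in> carrier ?N"
    then have p: "p \<in> A" by simp
    have "h ` {q \<in> A. h q \<sqsubseteq>\<^bsub>M\<^esub> h p} \<subseteq> {q \<in> carrier M. q \<sqsubseteq>\<^bsub>M\<^esub> h p}" using hM by auto
    then have "finite (h ` {q \<in> A. h q \<sqsubseteq>\<^bsub>M\<^esub> h p})" using lfM[OF hM[OF p]] finite_subset by blast
    then have "finite {q \<in> A. h q \<sqsubseteq>\<^bsub>M\<^esub> h p}"
      by (rule finite_imageD) (auto intro: inj_on_subset[OF inj])
    then show "finite {q \<in> carrier ?N. q \<sqsubseteq>\<^bsub>?N\<^esub> p}" by simp
  qed
  have ll: "x \<sqsubset>\<^bsub>?N\<^esub> y \<longleftrightarrow> h x \<sqsubset>\<^bsub>M\<^esub> h y" if "x \<in> A" "y \<in> A" for x y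
    using that inj_on_eq_iff[OF inj] by (simp add: lless_def ladder_eq[OF M])
  have "card {q. lower_cover ?N q p} \<le> n" if p: "p \<in> A" for p
  proof -
    have cov: "lower_cover M (h q) (h p)" if q: "lower_cover ?N q p" for q
    proof -
      have qA: "q \<in> A" using q by (simp add: lower_cover_def)
      have "\<not> (h q \<sqsubset>\<^bsub>M\<^esub> x \<and> x \<sqsubset>\<^bsub>M\<^esub> h p)" if x: "x \<in> carrier M" for x
      proof
        assume a: "h q \<sqsubset>\<^bsub>M\<^esub> x \<and> x \<sqsubset>\<^bsub>M\<^esub> h p"
        then have "x \<in> J" using down[OF hJ[OF p] x] by (simp add: lless_def)
        then obtain z where "z \<in> A" "x = h z" using im by auto
        then show False using q a ll qA p by (auto simp: lower_cover_def)
      qed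
      then show ?thesis using q ll qA p hM by (auto simp: lower_cover_def)
    qed
    have "finite {q. lower_cover M q (h p)}"
      by (rule finite_subset[OF _ lfM[OF hM[OF p]]]) (auto simp: lower_cover_def lless_def)
    then have "card {q. lower_cover ?N q p} \<le> card {q. lower_cover M q (h p)}"
      using cov by (intro card_inj_on_le[of h]) (auto intro!: inj_on_subset[OF inj] simp: lower_cover_def)
    also have "\<dots> \<le> n" using M hM[OF p] by (simp add: n_ladder_def)
    finally show ?thesis .
  qed
  then show ?thesis using lat lf by (simp add: n_ladder_def)
qed

lemma maximal_ladder_any_type:
  includes cardinal_syntax
  fixes L :: "('a, 'm) gorder_scheme"
  assumes inf: "infinite (UNIV :: 'b set)" and le: "carrier L \<lesssim> (UNIV :: 'b set)"
    and max: "maximal_ladder TYPE('b) n L"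
  shows "maximal_ladder TYPE('c) n L"
proof (rule ccontr)
  assume "\<not> maximal_ladder TYPE('c) n L"
  then obtain M :: "'c gorder" and I where M: "n_ladder n M" and I: "order_ideal I M"
    and ne: "I \<noteq> carrier M" and "order_isomorphic L (M\<lparr>carrier := I\<rparr>)"
    using max by (auto simp: maximal_ladder_def)
  then obtain f where f: "bij_betw f (carrier L) I" and fe: "order_emb L (M\<lparr>carrier := I\<rparr>) f"
    by (auto simp: order_isomorphic_def)
  note le_antisym = ladder_antisym[OF M] and le_trans = ladder_trans[OF M]
    and join_closed = ladder_join_closed[OF M] and join_left = ladder_join_left[OF M]
    and join_right = ladder_join_right[OF M] and join_le = ladder_join_le[OF M]
    and meet_closed = ladder_meet_closed[OF M] and meet_left = ladder_meet_left[OF M]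
    and meet_right = ladder_meet_right[OF M] and meet_le = ladder_meet_le[OF M]
    and lfM = ladder_finite[OF M]
  have IM: "I \<subseteq> carrier M" and Ine: "I \<noteq> {}"
    and down: "\<And>x y. x \<in> I \<Longrightarrow> y \<in> carrier M \<Longrightarrow> y \<sqsubseteq>\<^bsub>M\<^esub> x \<Longrightarrow> y \<in> I"
    and dir: "\<And>x y. x \<in> I \<Longrightarrow> y \<in> I \<Longrightarrow> \<exists>z \<in> I. x \<sqsubseteq>\<^bsub>M\<^esub> z \<and> y \<sqsubseteq>\<^bsub>M\<^esub> z"
    using I by (auto simp: order_ideal_def)
  obtain p where p: "p \<in> carrier M" "p \<notin> I" using ne IM by auto
  define J where "J = (\<Union>x \<in> I. {q \<in> carrier M. q \<sqsubseteq>\<^bsub>M\<^esub> x \<squnion>\<^bsub>M\<^esub> p})"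
  have IM': "x \<in> carrier M" if "x \<in> I" for x using that IM by blast
  have IJ: "I \<subseteq> J"
  proof
    fix x assume x: "x \<in> I"
    then show "x \<in> J" unfolding J_def using join_left[OF IM'[OF x] p(1)] IM' by blast
  qed
  have pJ: "p \<in> J"
  proof -
    obtain x where x: "x \<in> I" using Ine by blast
    then show ?thesis unfolding J_def using join_right[OF IM'[OF x] p(1)] p(1) by blast
  qed
  have J: "order_ideal J M"
    unfolding order_ideal_def
  proof (intro conjI ballI impI)
    show "J \<subseteq> carrier M" "J \<noteq> {}" using pJ by (auto simp: J_def)
  next
    fix x y assume "x \<in> J" "y \<in> carrier M" "y \<sqsubseteq>\<^bsub>M\<^esub> x"
    then obtain a where a: "a \<in> I" "x \<in> carrier M" "x \<sqsubseteq>\<^bsub>M\<^esub> a \<squnion>\<^bsub>M\<^esub> p" by (auto simp: J_def)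
    have "y \<sqsubseteq>\<^bsub>M\<^esub> a \<squnion>\<^bsub>M\<^esub> p"
      by (rule le_trans[OF \<open>y \<sqsubseteq>\<^bsub>M\<^esub> x\<close> a(3)]) (use a IM p join_closed \<open>y \<in> carrier M\<close> in auto)
    then show "y \<in> J" using a(1) \<open>y \<in> carrier M\<close> by (auto simp: J_def)
  next
    fix x y assume "x \<in> J" "y \<in> J"
    then obtain a b where ab: "a \<in> I" "b \<in> I" "x \<in> carrier M" "y \<in> carrier M"
      "x \<sqsubseteq>\<^bsub>M\<^esub> a \<squnion>\<^bsub>M\<^esub> p" "y \<sqsubseteq>\<^bsub>M\<^esub> b \<squnion>\<^bsub>M\<^esub> p" by (auto simp: J_def)
    obtain c where c: "c \<in> I" "a \<sqsubseteq>\<^bsub>M\<^esub> c" "b \<sqsubseteq>\<^bsub>M\<^esub> c" using dir ab by blast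
    have cM: "a \<in> carrier M" "b \<in> carrier M" "c \<in> carrier M" using ab c IM by auto
    have mono: "d \<squnion>\<^bsub>M\<^esub> p \<sqsubseteq>\<^bsub>M\<^esub> c \<squnion>\<^bsub>M\<^esub> p" if "d \<in> carrier M" "d \<sqsubseteq>\<^bsub>M\<^esub> c" for d
    proof (rule join_le)
      show "d \<sqsubseteq>\<^bsub>M\<^esub> c \<squnion>\<^bsub>M\<^esub> p"
        by (rule le_trans[OF that(2) join_left]) (use that cM p join_closed in auto)
    qed (use that cM p join_right join_closed in auto)
    show "\<exists>z \<in> J. x \<sqsubseteq>\<^bsub>M\<^esub> z \<and> y \<sqsubseteq>\<^bsub>M\<^esub> z"
    proof (intro bexI conjI)
      show "x \<sqsubseteq>\<^bsub>M\<^esub> c \<squnion>\<^bsub>M\<^esub> p"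
        by (rule le_trans[OF ab(5) mono]) (use ab c cM p join_closed in auto)
      show "y \<sqsubseteq>\<^bsub>M\<^esub> c \<squnion>\<^bsub>M\<^esub> p"
        by (rule le_trans[OF ab(6) mono]) (use ab c cM p join_closed in auto)
      show "c \<squnion>\<^bsub>M\<^esub> p \<in> J" unfolding J_def
        using c(1) join_closed[OF cM(3) p(1)] ladder_refl[OF M] by blast
    qed
  qed
  have "I \<lesssim> carrier L" using f eqpoll_imp_lepoll eqpoll_sym eqpoll_def by metis
  then have "I \<lesssim> (UNIV :: 'b set)" using le lepoll_trans by blast
  then have cI: "|I| \<le>o |UNIV :: 'b set|" unfolding lepoll_def card_of_ordLeq .
  have "|{q \<in> carrier M. q \<sqsubseteq>\<^bsub>M\<^esub> x \<squnion>\<^bsub>M\<^esub> p}| \<le>o |UNIV :: 'b set|" if x: "x \<in> I" for x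
  proof -
    have "x \<squnion>\<^bsub>M\<^esub> p \<in> carrier M" using join_closed[OF IM'[OF x] p(1)] .
    then have "finite {q \<in> carrier M. q \<sqsubseteq>\<^bsub>M\<^esub> x \<squnion>\<^bsub>M\<^esub> p}"
      using M unfolding n_ladder_def lower_finite_def by blast
    then show ?thesis using finite_lepoll_infinite[OF inf]
      unfolding lepoll_def card_of_ordLeq by blast
  qed
  then have "|J| \<le>o |UNIV :: 'b set|"
    unfolding J_def by (intro card_of_UNION_ordLeq_infinite[OF inf cI] ballI)
  then obtain g :: "'c \<Rightarrow> 'b" where g: "inj_on g J" unfolding card_of_ordLeq[symmetric] by blast
  define h where "h = inv_into J g"
  have h: "bij_betw h (g ` J) J" unfolding h_def using g
    by (simp add: bij_betw_inv_into bij_betw_imageI)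
  have hg: "h (g x) = x" if "x \<in> J" for x using that g by (simp add: h_def)
  let ?N = "\<lparr>carrier = g ` J, eq = (=), le = (\<lambda>x y. h x \<sqsubseteq>\<^bsub>M\<^esub> h y)\<rparr>"
  have N: "n_ladder n ?N" by (rule n_ladder_pullback[OF M J h])
  then interpret N: lattice ?N by (simp add: n_ladder_def)
  have gI: "order_ideal (g ` I) ?N"
    unfolding order_ideal_def
  proof (intro conjI ballI impI)
    show "g ` I \<subseteq> carrier ?N" "g ` I \<noteq> {}" using IJ Ine by auto
  next
    fix x y assume "x \<in> g ` I" "y \<in> carrier ?N" "y \<sqsubseteq>\<^bsub>?N\<^esub> x"
    then obtain a b where ab: "a \<in> I" "b \<in> J" "x = g a" "y = g b" "b \<sqsubseteq>\<^bsub>M\<^esub> a"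
      using IJ hg by auto
    then have "b \<in> I" using down[of a b] by (auto simp: J_def)
    then show "y \<in> g ` I" using ab by simp
  next
    fix x y assume "x \<in> g ` I" "y \<in> g ` I"
    then obtain a b where ab: "a \<in> I" "b \<in> I" "x = g a" "y = g b" by auto
    then obtain c where "c \<in> I" "a \<sqsubseteq>\<^bsub>M\<^esub> c" "b \<sqsubseteq>\<^bsub>M\<^esub> c" using dir by blast
    then show "\<exists>z \<in> g ` I. x \<sqsubseteq>\<^bsub>?N\<^esub> z \<and> y \<sqsubseteq>\<^bsub>?N\<^esub> z" using ab IJ hg
      by (auto intro!: bexI[of _ c] simp: subset_iff)
  qed
  have "g p \<notin> g ` I" using p pJ IJ g by (auto dest: inj_onD)
  then have gne: "g ` I \<noteq> carrier ?N" using pJ by auto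
  have "weak_partial_order (?N\<lparr>carrier := g ` I\<rparr>)"
    using IJ by (intro weak_partial_order_subset N.weak_partial_order_axioms) auto
  moreover have "f x \<in> I" if "x \<in> carrier L" for x using f that by (auto simp: bij_betw_def)
  ultimately have "order_emb L (?N\<lparr>carrier := g ` I\<rparr>) (g \<circ> f)"
    using fe IJ hg by (auto simp: order_emb_def subset_iff)
  moreover have "bij_betw (g \<circ> f) (carrier L) (carrier (?N\<lparr>carrier := g ` I\<rparr>))"
    using f inj_on_subset[OF g IJ] by (auto intro!: bij_betw_trans simp: bij_betw_imageI)
  ultimately have "order_isomorphic L (?N\<lparr>carrier := g ` I\<rparr>)"
    unfolding order_isomorphic_def by blast
  then show False using max N gI gne unfolding maximal_ladder_def by blast
qed

end

theory Submission
  imports Defs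
begin

text \<open>
  Suppose that \<open>L\<close> is embedded by \<open>f\<close> as a proper ideal of an \<open>n\<close>-ladder \<open>M\<close>, and fix \<open>p\<close>
  in \<open>M\<close> outside that ideal. Every \<open>q \<ge> p\<close> has a shadow \<open>r q\<close>, the greatest element of
  \<open>L\<close> whose image is below \<open>q\<close>; thus \<open>r\<close> is an upper adjoint of \<open>f\<close>, and so preserves meets.
  The shadows form a meet-subsemilattice \<open>C\<close> of \<open>L\<close>, cofinal because \<open>x\<close> is below the shadow
  of \<open>f x \<squnion> p\<close>. Each lower cover of \<open>c\<close> in \<open>C\<close> is the shadow of a lower cover of \<open>f c \<squnion> p\<close> that
  lies above \<open>p\<close>. Since \<open>f c\<close> is strictly below \<open>f c \<squnion> p\<close>, some lower cover of \<open>f c \<squnion> p\<close> lies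
  above \<open>f c\<close>, and hence not above \<open>p\<close>. One of the at most \<open>n\<close> lower covers is thus lost, and
  \<open>C\<close> is an \<open>(n - 1)\<close>-ladder (\<open>ladder_of_shadows\<close>).

  Conversely, given a cofinal meet-subsemilattice \<open>C\<close> that is an \<open>(n - 1)\<close>-ladder, put a second
  copy of \<open>C\<close> on top of \<open>L\<close>, placing the copy of \<open>c\<close> above everything below \<open>c\<close>. The copy of \<open>c\<close>
  covers only \<open>c\<close> itself and the copies of the lower covers of \<open>c\<close> in \<open>C\<close>, so the result is an
  \<open>n\<close>-ladder, and \<open>L\<close> is a proper ideal of it (\<open>n_ladder_two_layers\<close>).

  Both constructions visibly give a lower finite poset with meets in which any two elements are
  bounded above, by cofinality of \<open>C\<close>; joins then exist for free (\<open>directed_meet_semilattice_is_lattice\<close>).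
\<close>

section \<open>Lower finite posets\<close>

text \<open>
  The join of \<open>x\<close> and \<open>y\<close> is the infimum of those upper bounds that lie below one fixed upper
  bound \<open>u\<close>: there are finitely many of them, and meeting with \<open>u\<close> turns any upper bound into one
  of them.
\<close>

lemma directed_meet_semilattice_is_lattice:
  assumes po: "partial_order P" and lf: "lower_finite P"
    and glb: "\<And>x y. x \<in> carrier P \<Longrightarrow> y \<in> carrier P \<Longrightarrow> \<exists>m. greatest P m (Lower P {x, y})"
    and dir: "\<And>x y. x \<in> carrier P \<Longrightarrow> y \<in> carrier P \<Longrightarrow>
      \<exists>u \<in> carrier P. x \<sqsubseteq>\<^bsub>P\<^esub> u \<and> y \<sqsubseteq>\<^bsub>P\<^esub> u"
  shows "lattice P"
proof -
  interpret partial_order P by (rule po)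
  interpret weak_lower_semilattice P by unfold_locales (rule glb)
  show ?thesis
  proof
    fix x y assume xy: "x \<in> carrier P" "y \<in> carrier P"
    then show "\<exists>s. greatest P s (Lower P {x, y})" by (rule glb)
    obtain u where u: "u \<in> carrier P" "x \<sqsubseteq>\<^bsub>P\<^esub> u" "y \<sqsubseteq>\<^bsub>P\<^esub> u" using dir xy by blast
    define S where "S = {z \<in> carrier P. z \<sqsubseteq>\<^bsub>P\<^esub> u \<and> x \<sqsubseteq>\<^bsub>P\<^esub> z \<and> y \<sqsubseteq>\<^bsub>P\<^esub> z}"
    have "finite S"
      by (rule finite_subset[of _ "{q \<in> carrier P. q \<sqsubseteq>\<^bsub>P\<^esub> u}"])
        (use lf u in \<open>auto simp: S_def lower_finite_def\<close>)
    moreover have "S \<subseteq> carrier P" "S \<noteq> {}" using u by (auto simp: S_def)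
    ultimately have inf: "greatest P (\<Sqinter>\<^bsub>P\<^esub>S) (Lower P S)" by (rule finite_inf_greatest)
    let ?s = "\<Sqinter>\<^bsub>P\<^esub>S"
    have s: "?s \<in> carrier P" by (rule greatest_closed[OF inf])
    have below: "?s \<sqsubseteq>\<^bsub>P\<^esub> z" if "z \<in> carrier P" "x \<sqsubseteq>\<^bsub>P\<^esub> z" "y \<sqsubseteq>\<^bsub>P\<^esub> z" for z
    proof -
      have zu: "z \<sqinter>\<^bsub>P\<^esub> u \<in> carrier P" using that u by simp
      have "z \<sqinter>\<^bsub>P\<^esub> u \<in> S" unfolding S_def
        using that u xy zu by (auto intro: meet_le meet_right)
      then have "?s \<sqsubseteq>\<^bsub>P\<^esub> z \<sqinter>\<^bsub>P\<^esub> u" using inf by (auto simp: greatest_def Lower_def S_def)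
      then show ?thesis
        by (rule le_trans) (use that u s zu in \<open>auto intro: meet_left\<close>)
    qed
    have "a \<sqsubseteq>\<^bsub>P\<^esub> ?s" if "a \<in> carrier P" "\<forall>z \<in> S. a \<sqsubseteq>\<^bsub>P\<^esub> z" for a
      using inf that by (auto simp: greatest_def Lower_def S_def)
    then have "least P ?s (Upper P {x, y})"
      using below s xy by (auto simp: least_def Upper_def S_def)
    then show "\<exists>s. least P s (Upper P {x, y})" ..
  qed
qed

lemma finite_has_maximal_element:
  assumes po: "partial_order P" and S: "finite S" "S \<noteq> {}" "S \<subseteq> carrier P"
  shows "\<exists>m \<in> S. \<forall>x \<in> S. m \<sqsubseteq>\<^bsub>P\<^esub> x \<longrightarrow> x = m"
proof -
  interpret partial_order P by (rule po)
  have "asymp_on S (\<lambda>x y. x \<sqsubset>\<^bsub>P\<^esub> y)" "transp_on S (\<lambda>x y. x \<sqsubset>\<^bsub>P\<^esub> y)"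
    using S(3)
    by (auto intro!: asymp_onI transp_onI simp: lless_eq intro: le_trans dest: le_antisym)
  from Finite_Set.bex_max_element[OF S(1) this S(2)] show ?thesis
    by (auto simp: lless_eq)
qed

text \<open>In a finite set a maximal element exists, and directedness makes it greatest.\<close>

lemma finite_directed_has_greatest:
  assumes po: "partial_order P" and S: "finite S" "S \<noteq> {}" "S \<subseteq> carrier P"
    and dir: "\<And>x y. x \<in> S \<Longrightarrow> y \<in> S \<Longrightarrow> \<exists>z \<in> S. x \<sqsubseteq>\<^bsub>P\<^esub> z \<and> y \<sqsubseteq>\<^bsub>P\<^esub> z"
  shows "\<exists>m \<in> S. \<forall>x \<in> S. x \<sqsubseteq>\<^bsub>P\<^esub> m"
proof -
  obtain m where m: "m \<in> S" "\<And>x. x \<in> S \<Longrightarrow> m \<sqsubseteq>\<^bsub>P\<^esub> x \<Longrightarrow> x = m"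
    using finite_has_maximal_element[OF po S] by blast
  have "x \<sqsubseteq>\<^bsub>P\<^esub> m" if "x \<in> S" for x
    using dir[OF m(1) that] m(2) by blast
  then show ?thesis using m(1) by blast
qed

lemma lower_cover_between:
  assumes po: "partial_order P" and lf: "lower_finite P"
    and xy: "x \<in> carrier P" "y \<in> carrier P" "x \<sqsubset>\<^bsub>P\<^esub> y"
  shows "\<exists>d. lower_cover P d y \<and> x \<sqsubseteq>\<^bsub>P\<^esub> d"
proof -
  interpret partial_order P by (rule po)
  define S where "S = {z \<in> carrier P. x \<sqsubseteq>\<^bsub>P\<^esub> z \<and> z \<sqsubset>\<^bsub>P\<^esub> y}"
  have "finite S"
    by (rule finite_subset[of _ "{q \<in> carrier P. q \<sqsubseteq>\<^bsub>P\<^esub> y}"])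
      (use lf xy in \<open>auto simp: S_def lower_finite_def lless_eq\<close>)
  moreover have "S \<noteq> {}" using xy by (auto simp: S_def)
  moreover have "S \<subseteq> carrier P" by (auto simp: S_def)
  ultimately obtain d where d: "d \<in> S" "\<And>z. z \<in> S \<Longrightarrow> d \<sqsubseteq>\<^bsub>P\<^esub> z \<Longrightarrow> z = d"
    using finite_has_maximal_element[OF po, of S] by blast
  have "\<not> (d \<sqsubset>\<^bsub>P\<^esub> z \<and> z \<sqsubset>\<^bsub>P\<^esub> y)" if z: "z \<in> carrier P" for z
  proof
    assume a: "d \<sqsubset>\<^bsub>P\<^esub> z \<and> z \<sqsubset>\<^bsub>P\<^esub> y"
    then have "x \<sqsubseteq>\<^bsub>P\<^esub> z" using d(1) z xy(1) by (auto simp: S_def lless_eq intro: le_trans)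
    then have "z \<in> S" using a z by (simp add: S_def)
    then show False using d(2) a by (auto simp: lless_eq)
  qed
  then have "lower_cover P d y" using d(1) xy by (auto simp: lower_cover_def S_def)
  then show ?thesis using d(1) by (auto simp: S_def)
qed

lemma finite_lower_covers:
  assumes "lower_finite P"
  shows "finite {q. lower_cover P q p}"
proof (cases "p \<in> carrier P")
  case True
  then have "finite {q \<in> carrier P. q \<sqsubseteq>\<^bsub>P\<^esub> p}"
    using assms by (simp add: lower_finite_def)
  then show ?thesis
    by (rule rev_finite_subset) (simp add: subset_iff lower_cover_def lless_def)
qed (simp add: lower_cover_def)

lemma partial_order_subset:
  assumes "partial_order P" and "A \<subseteq> carrier P"
  shows "partial_order (P\<lparr>carrier := A\<rparr>)"
  using weak_partial_order_subset[of P A] assms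
  by (simp add: partial_order_def partial_order_axioms_def)

text \<open>A cofinal meet-subsemilattice inherits everything that is needed for being a lattice,
  although its joins may be larger than those of the ambient lattice.\<close>

lemma cofinal_meet_subsemilattice_is_lattice:
  assumes L: "n_ladder n L" and C: "meet_subsemilattice C L" and cof: "cofinal_in C L"
  shows "lattice (L\<lparr>carrier := C\<rparr>)" and "lower_finite (L\<lparr>carrier := C\<rparr>)"
proof -
  interpret L: lattice L by (rule ladder_lattice[OF L])
  have CL: "C \<subseteq> carrier L" and meetC: "\<And>x y. x \<in> C \<Longrightarrow> y \<in> C \<Longrightarrow> x \<sqinter>\<^bsub>L\<^esub> y \<in> C"
    using C by (auto simp: meet_subsemilattice_def)
  have inL: "x \<in> carrier L" if "x \<in> C" for x using that CL by blast
  show lf: "lower_finite (L\<lparr>carrier := C\<rparr>)"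
    unfolding lower_finite_def
  proof
    fix c assume "c \<in> carrier (L\<lparr>carrier := C\<rparr>)"
    then have "finite {q \<in> carrier L. q \<sqsubseteq>\<^bsub>L\<^esub> c}" using ladder_finite[OF L] inL by simp
    then show "finite {q \<in> carrier (L\<lparr>carrier := C\<rparr>). q \<sqsubseteq>\<^bsub>L\<lparr>carrier := C\<rparr>\<^esub> c}"
      by (rule rev_finite_subset) (use inL in auto)
  qed
  show "lattice (L\<lparr>carrier := C\<rparr>)"
  proof (rule directed_meet_semilattice_is_lattice[OF _ lf])
    show "partial_order (L\<lparr>carrier := C\<rparr>)"
      by (rule partial_order_subset[OF L.partial_order_axioms CL])
  next
    fix x y assume "x \<in> carrier (L\<lparr>carrier := C\<rparr>)" "y \<in> carrier (L\<lparr>carrier := C\<rparr>)"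
    then have xy: "x \<in> C" "y \<in> C" by auto
    have "greatest (L\<lparr>carrier := C\<rparr>) (x \<sqinter>\<^bsub>L\<^esub> y) (Lower (L\<lparr>carrier := C\<rparr>) {x, y})"
      using xy meetC inL L.meet_left L.meet_right L.meet_le
      by (auto simp: greatest_def Lower_def)
    then show "\<exists>m. greatest (L\<lparr>carrier := C\<rparr>) m (Lower (L\<lparr>carrier := C\<rparr>) {x, y})" ..
    obtain u where u: "u \<in> C" "x \<squnion>\<^bsub>L\<^esub> y \<sqsubseteq>\<^bsub>L\<^esub> u"
      using cof L.join_closed[OF inL inL, OF xy] by (auto simp: cofinal_in_def)
    have xyL: "x \<in> carrier L" "y \<in> carrier L" "u \<in> carrier L" using xy u inL by auto
    have "x \<sqsubseteq>\<^bsub>L\<^esub> u" "y \<sqsubseteq>\<^bsub>L\<^esub> u"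
      using L.le_trans[OF L.join_left u(2)] L.le_trans[OF L.join_right u(2)] xyL by auto
    then show "\<exists>u \<in> carrier (L\<lparr>carrier := C\<rparr>).
        x \<sqsubseteq>\<^bsub>L\<lparr>carrier := C\<rparr>\<^esub> u \<and> y \<sqsubseteq>\<^bsub>L\<lparr>carrier := C\<rparr>\<^esub> u"
      using u(1) by auto
  qed
qed

section \<open>Shadows of elements above an ideal\<close>

text \<open>
  An embedding onto an ideal has an upper adjoint: the elements of \<open>L\<close> whose image is below \<open>q\<close>
  form a finite set, directed because an upper bound of two of them may be cut down by meeting its
  image with \<open>q\<close>.
\<close>

lemma ideal_embedding_has_upper_adjoint:
  assumes M: "n_ladder n M" and L: "n_ladder k L"
    and I: "order_ideal (f ` carrier L) M" and inj: "inj_on f (carrier L)"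
    and emb: "\<And>x y. x \<in> carrier L \<Longrightarrow> y \<in> carrier L \<Longrightarrow> f x \<sqsubseteq>\<^bsub>M\<^esub> f y \<longleftrightarrow> x \<sqsubseteq>\<^bsub>L\<^esub> y"
  shows "\<exists>r. \<forall>q \<in> carrier M. r q \<in> carrier L \<and>
    (\<forall>x \<in> carrier L. f x \<sqsubseteq>\<^bsub>M\<^esub> q \<longleftrightarrow> x \<sqsubseteq>\<^bsub>L\<^esub> r q)"
proof -
  interpret L: lattice L by (rule ladder_lattice[OF L])
  interpret M: lattice M by (rule ladder_lattice[OF M])
  have fM: "f x \<in> carrier M" if "x \<in> carrier L" for x
    using I that by (auto simp: order_ideal_def)
  have down: "\<exists>z \<in> carrier L. y = f z" if "x \<in> carrier L" "y \<in> carrier M" "y \<sqsubseteq>\<^bsub>M\<^esub> f x" for x y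
    using I that by (auto simp: order_ideal_def)
  have dir: "\<exists>w \<in> carrier L. f x \<sqsubseteq>\<^bsub>M\<^esub> f w \<and> f y \<sqsubseteq>\<^bsub>M\<^esub> f w"
    if "x \<in> carrier L" "y \<in> carrier L" for x y
    using I that by (auto simp: order_ideal_def)
  have cut: "\<exists>z \<in> carrier L. f z = f w \<sqinter>\<^bsub>M\<^esub> q" if "w \<in> carrier L" "q \<in> carrier M" for w q
    using down[OF that(1), of "f w \<sqinter>\<^bsub>M\<^esub> q"] M.meet_left[of "f w" q] that fM by force
  have "\<exists>s. s \<in> carrier L \<and> (\<forall>x \<in> carrier L. f x \<sqsubseteq>\<^bsub>M\<^esub> q \<longleftrightarrow> x \<sqsubseteq>\<^bsub>L\<^esub> s)"
    if q: "q \<in> carrier M" for q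
  proof -
    define S where "S = {x \<in> carrier L. f x \<sqsubseteq>\<^bsub>M\<^esub> q}"
    have "finite (f ` S)"
      by (rule finite_subset[OF _ ladder_finite[OF M q]]) (auto simp: S_def fM)
    then have "finite S"
      by (rule finite_imageD) (auto simp: S_def intro: inj_on_subset[OF inj])
    moreover have "S \<noteq> {}"
    proof -
      obtain w where w: "w \<in> carrier L" using I by (auto simp: order_ideal_def)
      then obtain z where "z \<in> carrier L" "f z = f w \<sqinter>\<^bsub>M\<^esub> q" using cut q by blast
      then show ?thesis using M.meet_right[OF fM[OF w] q] by (auto simp: S_def)
    qed
    moreover have "S \<subseteq> carrier L" by (auto simp: S_def)
    moreover have "\<exists>z \<in> S. x \<sqsubseteq>\<^bsub>L\<^esub> z \<and> y \<sqsubseteq>\<^bsub>L\<^esub> z" if "x \<in> S" "y \<in> S" for x y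
    proof -
      have xy: "x \<in> carrier L" "y \<in> carrier L" "f x \<sqsubseteq>\<^bsub>M\<^esub> q" "f y \<sqsubseteq>\<^bsub>M\<^esub> q"
        using that by (auto simp: S_def)
      then obtain w where w: "w \<in> carrier L" "f x \<sqsubseteq>\<^bsub>M\<^esub> f w" "f y \<sqsubseteq>\<^bsub>M\<^esub> f w" using dir by blast
      then obtain z where z: "z \<in> carrier L" "f z = f w \<sqinter>\<^bsub>M\<^esub> q" using cut q by blast
      have "f x \<sqsubseteq>\<^bsub>M\<^esub> f z" "f y \<sqsubseteq>\<^bsub>M\<^esub> f z" "f z \<sqsubseteq>\<^bsub>M\<^esub> q"
        unfolding z(2) using xy w q fM by (auto intro: M.meet_le M.meet_right)
      then show ?thesis using z(1) xy emb by (auto simp: S_def)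
    qed
    ultimately obtain s where s: "s \<in> S" "\<And>x. x \<in> S \<Longrightarrow> x \<sqsubseteq>\<^bsub>L\<^esub> s"
      using finite_directed_has_greatest[OF L.partial_order_axioms, of S] by blast
    have "f x \<sqsubseteq>\<^bsub>M\<^esub> q" if "x \<in> carrier L" "x \<sqsubseteq>\<^bsub>L\<^esub> s" for x
      by (rule M.le_trans[of _ "f s"]) (use that s(1) emb fM q in \<open>auto simp: S_def\<close>)
    then show ?thesis using s by (auto simp: S_def)
  qed
  then show ?thesis by metis
qed

text \<open>
  The count drops by one because \<open>d \<mapsto> r d\<close> maps the lower covers \<open>d\<close> of \<open>f c \<squnion> p\<close> with
  \<open>p \<le> d\<close> onto a set containing all lower covers of \<open>c\<close> among the shadows, and \<open>p\<close> being outside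
  the ideal forces some lower cover of \<open>f c \<squnion> p\<close> to miss \<open>p\<close>.
\<close>

lemma ladder_of_shadows:
  assumes M: "n_ladder n M" and L: "n_ladder k L"
    and I: "order_ideal (f ` carrier L) M" and inj: "inj_on f (carrier L)"
    and emb: "\<And>x y. x \<in> carrier L \<Longrightarrow> y \<in> carrier L \<Longrightarrow> f x \<sqsubseteq>\<^bsub>M\<^esub> f y \<longleftrightarrow> x \<sqsubseteq>\<^bsub>L\<^esub> y"
    and p: "p \<in> carrier M" "p \<notin> f ` carrier L"
  shows "\<exists>C. meet_subsemilattice C L \<and> cofinal_in C L \<and> n_ladder (n - 1) (L\<lparr>carrier := C\<rparr>)"
proof -
  interpret L: lattice L by (rule ladder_lattice[OF L])
  interpret M: lattice M by (rule ladder_lattice[OF M])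
  obtain r where rL: "\<And>q. q \<in> carrier M \<Longrightarrow> r q \<in> carrier L"
    and adj: "\<And>x q. x \<in> carrier L \<Longrightarrow> q \<in> carrier M \<Longrightarrow> f x \<sqsubseteq>\<^bsub>M\<^esub> q \<longleftrightarrow> x \<sqsubseteq>\<^bsub>L\<^esub> r q"
    using ideal_embedding_has_upper_adjoint[OF M L I inj emb] by blast
  have fM: "f x \<in> carrier M" if "x \<in> carrier L" for x
    using I that by (auto simp: order_ideal_def)
  have frq: "f (r q) \<sqsubseteq>\<^bsub>M\<^esub> q" if "q \<in> carrier M" for q using adj rL that by simp
  have mono: "r q \<sqsubseteq>\<^bsub>L\<^esub> r q'" if "q \<in> carrier M" "q' \<in> carrier M" "q \<sqsubseteq>\<^bsub>M\<^esub> q'" for q q'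
    using M.le_trans[OF frq that(3)] adj rL fM that by auto
  define C where "C = r ` {q \<in> carrier M. p \<sqsubseteq>\<^bsub>M\<^esub> q}"
  have CL: "C \<subseteq> carrier L" using rL by (auto simp: C_def)
  have above: "f c \<squnion>\<^bsub>M\<^esub> p \<in> carrier M" "f c \<sqsubseteq>\<^bsub>M\<^esub> f c \<squnion>\<^bsub>M\<^esub> p" "p \<sqsubseteq>\<^bsub>M\<^esub> f c \<squnion>\<^bsub>M\<^esub> p"
    if "c \<in> carrier L" for c
    using fM[OF that] p(1) M.join_left M.join_right by auto
  have C: "meet_subsemilattice C L"
    unfolding meet_subsemilattice_def
  proof (intro conjI ballI)
    show "C \<subseteq> carrier L" by (rule CL)
    show "C \<noteq> {}" using p(1) by (auto simp: C_def)
    fix x y assume "x \<in> C" "y \<in> C"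
    then obtain q q' where q: "q \<in> carrier M" "p \<sqsubseteq>\<^bsub>M\<^esub> q" "x = r q"
      and q': "q' \<in> carrier M" "p \<sqsubseteq>\<^bsub>M\<^esub> q'" "y = r q'" by (auto simp: C_def)
    have qq: "q \<sqinter>\<^bsub>M\<^esub> q' \<in> carrier M" using q q' by simp
    have xy: "x \<in> carrier L" "y \<in> carrier L" using q q' rL by auto
    have "r (q \<sqinter>\<^bsub>M\<^esub> q') = x \<sqinter>\<^bsub>L\<^esub> y"
    proof (rule L.le_antisym)
      show "r (q \<sqinter>\<^bsub>M\<^esub> q') \<sqsubseteq>\<^bsub>L\<^esub> x \<sqinter>\<^bsub>L\<^esub> y"
        using mono[OF qq] q q' M.meet_left M.meet_right rL[OF qq] xy by (auto intro: L.meet_le)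
      have m: "x \<sqinter>\<^bsub>L\<^esub> y \<in> carrier L" using xy by simp
      then have "f (x \<sqinter>\<^bsub>L\<^esub> y) \<sqsubseteq>\<^bsub>M\<^esub> q" "f (x \<sqinter>\<^bsub>L\<^esub> y) \<sqsubseteq>\<^bsub>M\<^esub> q'"
        using adj q q' xy L.meet_left L.meet_right by auto
      then have "f (x \<sqinter>\<^bsub>L\<^esub> y) \<sqsubseteq>\<^bsub>M\<^esub> q \<sqinter>\<^bsub>M\<^esub> q'"
        using fM[OF m] q q' by (auto intro: M.meet_le)
      then show "x \<sqinter>\<^bsub>L\<^esub> y \<sqsubseteq>\<^bsub>L\<^esub> r (q \<sqinter>\<^bsub>M\<^esub> q')" using adj m qq by simp
    qed (use xy rL qq in auto)
    moreover have "p \<sqsubseteq>\<^bsub>M\<^esub> q \<sqinter>\<^bsub>M\<^esub> q'" using q q' p(1) by (auto intro: M.meet_le)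
    ultimately show "x \<sqinter>\<^bsub>L\<^esub> y \<in> C" using qq unfolding C_def by (metis (mono_tags) CollectI imageI)
  qed
  have cof: "cofinal_in C L"
    unfolding cofinal_in_def
  proof (intro conjI ballI CL)
    fix x assume x: "x \<in> carrier L"
    have "r (f x \<squnion>\<^bsub>M\<^esub> p) \<in> C" "x \<sqsubseteq>\<^bsub>L\<^esub> r (f x \<squnion>\<^bsub>M\<^esub> p)"
      using above[OF x] adj[OF x] by (auto simp: C_def)
    then show "\<exists>c \<in> C. x \<sqsubseteq>\<^bsub>L\<^esub> c" by blast
  qed
  \<comment> \<open>The elements of \<open>C\<close> are the closed elements of the closure operator \<open>x \<mapsto> r (f x \<squnion> p)\<close>.\<close>
  have closed: "r (f c \<squnion>\<^bsub>M\<^esub> p) = c" if cC: "c \<in> C" for c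
  proof -
    obtain q where q: "q \<in> carrier M" "p \<sqsubseteq>\<^bsub>M\<^esub> q" "c = r q" using cC by (auto simp: C_def)
    have c: "c \<in> carrier L" using cC CL by blast
    have "f c \<squnion>\<^bsub>M\<^esub> p \<sqsubseteq>\<^bsub>M\<^esub> q" using q frq[OF q(1)] fM[OF c] p(1) by (auto intro: M.join_le)
    then have "r (f c \<squnion>\<^bsub>M\<^esub> p) \<sqsubseteq>\<^bsub>L\<^esub> c" using mono above[OF c] q by simp
    moreover have "c \<sqsubseteq>\<^bsub>L\<^esub> r (f c \<squnion>\<^bsub>M\<^esub> p)" using above[OF c] adj[OF c] by simp
    ultimately show ?thesis using c rL above[OF c] by (auto intro: L.le_antisym)
  qed
  have "card {d. lower_cover (L\<lparr>carrier := C\<rparr>) d c} \<le> n - 1" if cC: "c \<in> C" for c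
  proof -
    have c: "c \<in> carrier L" using cC CL by blast
    let ?t = "f c \<squnion>\<^bsub>M\<^esub> p"
    note t = above[OF c]
    define K where "K = {d. lower_cover M d ?t}"
    have lfM: "lower_finite M" using M by (simp add: n_ladder_def)
    have K: "finite K" "card K \<le> n"
      using finite_lower_covers[OF lfM] M t(1) by (auto simp: K_def n_ladder_def)
    have "f c \<noteq> ?t"
    proof
      assume "f c = ?t"
      then show False using t(3) p I c by (auto simp: order_ideal_def)
    qed
    then have "f c \<sqsubset>\<^bsub>M\<^esub> ?t" using t(2) by (simp add: M.lless_eq)
    then obtain d\<^sub>0 where d\<^sub>0: "d\<^sub>0 \<in> K" "f c \<sqsubseteq>\<^bsub>M\<^esub> d\<^sub>0"
      using lower_cover_between[OF M.partial_order_axioms lfM fM[OF c] t(1)]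
      by (auto simp: K_def)
    \<comment> \<open>Whatever is above both \<open>f c\<close> and \<open>p\<close> is above their join, which its lower covers are not.\<close>
    have notp: "\<not> p \<sqsubseteq>\<^bsub>M\<^esub> d" if "d \<in> K" "f c \<sqsubseteq>\<^bsub>M\<^esub> d" for d
    proof
      assume pd: "p \<sqsubseteq>\<^bsub>M\<^esub> d"
      have d: "d \<in> carrier M" "d \<sqsubseteq>\<^bsub>M\<^esub> ?t" "d \<noteq> ?t"
        using that(1) by (auto simp: K_def lower_cover_def M.lless_eq)
      have "?t \<sqsubseteq>\<^bsub>M\<^esub> d" using pd that(2) d(1) p(1) fM[OF c] by (auto intro: M.join_le)
      then show False using d t(1) by (auto dest: M.le_antisym)
    qed
    have "{d. lower_cover (L\<lparr>carrier := C\<rparr>) d c} \<subseteq> r ` (K - {d\<^sub>0})"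
    proof
      fix b assume "b \<in> {d. lower_cover (L\<lparr>carrier := C\<rparr>) d c}"
      then have b: "b \<in> C" "b \<sqsubseteq>\<^bsub>L\<^esub> c" "b \<noteq> c"
        and nb: "\<And>x. x \<in> C \<Longrightarrow> b \<sqsubseteq>\<^bsub>L\<^esub> x \<Longrightarrow> x \<sqsubseteq>\<^bsub>L\<^esub> c \<Longrightarrow> x = b \<or> x = c"
        by (auto simp: lower_cover_def lless_def L.eq_is_equal)
      have bL: "b \<in> carrier L" using b CL by blast
      note s = above[OF bL]
      have "f b \<sqsubseteq>\<^bsub>M\<^esub> ?t" using M.le_trans[OF _ t(2)] emb[OF bL c] b(2) fM bL c t(1) by auto
      then have "f b \<squnion>\<^bsub>M\<^esub> p \<sqsubseteq>\<^bsub>M\<^esub> ?t" using t fM[OF bL] p(1) by (auto intro: M.join_le)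
      moreover have "f b \<squnion>\<^bsub>M\<^esub> p \<noteq> ?t" using closed b cC by metis
      ultimately have "f b \<squnion>\<^bsub>M\<^esub> p \<sqsubset>\<^bsub>M\<^esub> ?t" by (simp add: M.lless_eq)
      then obtain d where d: "d \<in> K" "f b \<squnion>\<^bsub>M\<^esub> p \<sqsubseteq>\<^bsub>M\<^esub> d"
        using lower_cover_between[OF M.partial_order_axioms lfM s(1) t(1)] by (auto simp: K_def)
      have dM: "d \<in> carrier M" "d \<sqsubseteq>\<^bsub>M\<^esub> ?t"
        using d(1) by (auto simp: K_def lower_cover_def M.lless_eq)
      have pd: "p \<sqsubseteq>\<^bsub>M\<^esub> d" using M.le_trans[OF s(3) d(2)] p(1) s(1) dM(1) by simp
      have "r d \<in> C" using pd dM(1) by (auto simp: C_def)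
      moreover have "b \<sqsubseteq>\<^bsub>L\<^esub> r d" using mono[OF s(1) dM(1) d(2)] closed[OF b(1)] by simp
      moreover have "r d \<sqsubseteq>\<^bsub>L\<^esub> c" using mono[OF dM(1) t(1) dM(2)] closed[OF cC] by simp
      moreover have "r d \<noteq> c" using notp[OF d(1)] pd frq[OF dM(1)] by auto
      ultimately have "r d = b" using nb by blast
      moreover have "d \<noteq> d\<^sub>0" using pd notp[OF d\<^sub>0] by auto
      ultimately show "b \<in> r ` (K - {d\<^sub>0})" using d(1) by blast
    qed
    then have "card {d. lower_cover (L\<lparr>carrier := C\<rparr>) d c} \<le> card (K - {d\<^sub>0})"
      using K(1) by (intro surj_card_le) auto
    also have "\<dots> \<le> n - 1" using K d\<^sub>0(1) by simp
    finally show ?thesis .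
  qed
  then have "n_ladder (n - 1) (L\<lparr>carrier := C\<rparr>)"
    using cofinal_meet_subsemilattice_is_lattice[OF L C cof] by (simp add: n_ladder_def)
  then show ?thesis using C cof by blast
qed

section \<open>Putting a copy of a subsemilattice on top\<close>

text \<open>
  The extension is realised inside the product of \<open>L\<close> with the two-element chain: \<open>False\<close> marks the
  elements of \<open>L\<close> and \<open>True\<close> those of the copy of \<open>C\<close>.
\<close>

definition two_layers :: "('a, 'm) gorder_scheme \<Rightarrow> 'a set \<Rightarrow> ('a \<times> bool) gorder" where
  "two_layers L C =
     \<lparr>carrier = carrier L \<times> {False} \<union> C \<times> {True}, eq = (=),
      le = (\<lambda>x y. fst x \<sqsubseteq>\<^bsub>L\<^esub> fst y \<and> (snd x \<longrightarrow> snd y))\<rparr>"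

lemma n_ladder_two_layers:
  assumes n: "1 \<le> n" and L: "n_ladder n L"
    and C: "meet_subsemilattice C L" and cof: "cofinal_in C L"
    and CI: "n_ladder (n - 1) (L\<lparr>carrier := C\<rparr>)"
  shows "n_ladder n (two_layers L C)" (is "n_ladder n ?M")
proof -
  interpret L: lattice L by (rule ladder_lattice[OF L])
  have CL: "C \<subseteq> carrier L" and meetC: "\<And>x y. x \<in> C \<Longrightarrow> y \<in> C \<Longrightarrow> x \<sqinter>\<^bsub>L\<^esub> y \<in> C"
    using C by (auto simp: meet_subsemilattice_def)
  have inL: "x \<in> carrier L" if "x \<in> C" for x using that CL by blast
  have car: "(x, b) \<in> carrier ?M \<longleftrightarrow> x \<in> carrier L \<and> (b \<longrightarrow> x \<in> C)" for x b
    using CL by (cases b) (auto simp: two_layers_def)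
  have le: "(x, a) \<sqsubseteq>\<^bsub>?M\<^esub> (y, b) \<longleftrightarrow> x \<sqsubseteq>\<^bsub>L\<^esub> y \<and> (a \<longrightarrow> b)" for x y a b
    by (simp add: two_layers_def)
  have eqM: "eq ?M = (=)" by (simp add: two_layers_def)
  have po: "partial_order ?M"
    by unfold_locales (auto simp: eqM car le intro: L.le_trans L.le_antisym)
  have lf: "lower_finite ?M"
    unfolding lower_finite_def
  proof
    fix p assume p: "p \<in> carrier ?M"
    obtain x b where pxb: "p = (x, b)" by force
    have "finite ({q \<in> carrier L. q \<sqsubseteq>\<^bsub>L\<^esub> x} \<times> (UNIV :: bool set))"
      using ladder_finite[OF L] p by (simp add: pxb car)
    then show "finite {q \<in> carrier ?M. q \<sqsubseteq>\<^bsub>?M\<^esub> p}"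
      by (rule rev_finite_subset) (auto simp: pxb car le)
  qed
  have "lattice ?M"
  proof (rule directed_meet_semilattice_is_lattice[OF po lf])
    fix u v assume uv: "u \<in> carrier ?M" "v \<in> carrier ?M"
    obtain x a y b where eqs: "u = (x, a)" "v = (y, b)" by force
    have xy: "x \<in> carrier L" "y \<in> carrier L" using uv by (auto simp: eqs car)
    have "(x \<sqinter>\<^bsub>L\<^esub> y, a \<and> b) \<in> carrier ?M" using uv meetC by (auto simp: eqs car)
    moreover have low: "w \<in> Lower ?M {u, v} \<longleftrightarrow> w \<in> carrier ?M \<and> w \<sqsubseteq>\<^bsub>?M\<^esub> u \<and> w \<sqsubseteq>\<^bsub>?M\<^esub> v" for w
      using uv unfolding Lower_def by blast
    ultimately have "greatest ?M (x \<sqinter>\<^bsub>L\<^esub> y, a \<and> b) (Lower ?M {u, v})"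
      using xy L.meet_left L.meet_right L.meet_le
      unfolding greatest_def by (auto simp: low eqs le car)
    then show "\<exists>m. greatest ?M m (Lower ?M {u, v})" ..
    obtain c where c: "c \<in> C" "x \<squnion>\<^bsub>L\<^esub> y \<sqsubseteq>\<^bsub>L\<^esub> c"
      using cof L.join_closed[OF xy] by (auto simp: cofinal_in_def)
    have "x \<sqsubseteq>\<^bsub>L\<^esub> c" "y \<sqsubseteq>\<^bsub>L\<^esub> c"
      using L.le_trans[OF L.join_left c(2)] L.le_trans[OF L.join_right c(2)] xy inL[OF c(1)] by auto
    then show "\<exists>w \<in> carrier ?M. u \<sqsubseteq>\<^bsub>?M\<^esub> w \<and> v \<sqsubseteq>\<^bsub>?M\<^esub> w"
      using c(1) inL by (intro bexI[of _ "(c, True)"]) (auto simp: eqs le car)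
  qed
  moreover have "card {q. lower_cover ?M q p} \<le> n" if p: "p \<in> carrier ?M" for p
  proof -
    obtain x b where pxb: "p = (x, b)" by force
    have x: "x \<in> carrier L" using p by (simp add: pxb car)
    have ll: "(y, a) \<sqsubset>\<^bsub>?M\<^esub> (z, b) \<longleftrightarrow> y \<sqsubseteq>\<^bsub>L\<^esub> z \<and> (a \<longrightarrow> b) \<and> (y \<noteq> z \<or> a \<noteq> b)" for y z a b
      by (auto simp: lless_def eqM le)
    have llL: "y \<sqsubset>\<^bsub>L\<^esub> z \<longleftrightarrow> y \<sqsubseteq>\<^bsub>L\<^esub> z \<and> y \<noteq> z" for y z by (rule L.lless_eq)
    have gap: "\<And>z c. (z, c) \<in> carrier ?M \<Longrightarrow> q \<sqsubset>\<^bsub>?M\<^esub> (z, c) \<Longrightarrow> \<not> (z, c) \<sqsubset>\<^bsub>?M\<^esub> p"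
      if "lower_cover ?M q p" for q using that by (auto simp: lower_cover_def)
    show ?thesis
    proof (cases b)
      case False
      have "lower_cover L y x \<and> \<not> a" if q: "lower_cover ?M (y, a) p" for y a
      proof -
        have y: "y \<in> carrier L" "y \<sqsubset>\<^bsub>L\<^esub> x" "\<not> a"
          using q False by (auto simp: lower_cover_def pxb car ll llL)
        moreover have "\<not> (y \<sqsubset>\<^bsub>L\<^esub> z \<and> z \<sqsubset>\<^bsub>L\<^esub> x)" if "z \<in> carrier L" for z
          using gap[OF q, of z False] that y(3) False by (auto simp: pxb car ll llL)
        ultimately show ?thesis using x by (auto simp: lower_cover_def)
      qed
      then have "{q. lower_cover ?M q p} \<subseteq> (\<lambda>y. (y, False)) ` {y. lower_cover L y x}" by force
      then have "card {q. lower_cover ?M q p} \<le> card {y. lower_cover L y x}"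
        using finite_lower_covers[of L] L by (intro surj_card_le) (auto simp: n_ladder_def)
      also have "\<dots> \<le> n" using L x by (simp add: n_ladder_def)
      finally show ?thesis .
    next
      case True
      then have xC: "x \<in> C" using p by (simp add: pxb car)
      let ?D = "{y. lower_cover (L\<lparr>carrier := C\<rparr>) y x}"
      have "q \<in> insert (x, False) ((\<lambda>y. (y, True)) ` ?D)" if "lower_cover ?M q p" for q
      proof -
        obtain y a where ya: "q = (y, a)" by force
        note q = that[unfolded ya]
        show ?thesis
        proof (cases a)
          case True
          have y: "y \<in> C" "y \<sqsubseteq>\<^bsub>L\<^esub> x" "y \<noteq> x"
            using q \<open>b\<close> True by (auto simp: lower_cover_def pxb car ll)
          moreover have "\<not> (y \<sqsubset>\<^bsub>L\<^esub> z \<and> z \<sqsubset>\<^bsub>L\<^esub> x)" if "z \<in> C" for z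
            using gap[OF q, of z True] that inL True \<open>b\<close> by (auto simp: pxb car ll llL)
          ultimately have "y \<in> ?D"
            using xC by (auto simp: lower_cover_def lless_def L.eq_is_equal)
          then show ?thesis using True ya by simp
        next
          case False
          have "y \<sqsubseteq>\<^bsub>L\<^esub> x" using q by (auto simp: lower_cover_def pxb ll)
          \<comment> \<open>Below the copy of \<open>x\<close>, every element of \<open>L\<close> lies below \<open>x\<close> itself.\<close>
          then have "y = x"
            using gap[OF q, of x False] x False \<open>b\<close> L.le_refl[OF x] by (auto simp: pxb car ll)
          then show ?thesis using False ya by simp
        qed
      qed
      then have sub: "{q. lower_cover ?M q p} \<subseteq> insert (x, False) ((\<lambda>y. (y, True)) ` ?D)" by blast
      have fin: "finite ?D"
        using CI by (intro finite_lower_covers) (simp add: n_ladder_def)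
      have "card {q. lower_cover ?M q p} \<le> card (insert (x, False) ((\<lambda>y. (y, True)) ` ?D))"
        using fin by (intro card_mono sub) simp
      also have "\<dots> \<le> Suc (card ?D)"
        using fin card_image_le[OF fin, of "\<lambda>y. (y, True)"] by (simp add: card_insert_if)
      also have "\<dots> \<le> n" using CI xC n by (force simp: n_ladder_def)
      finally show ?thesis .
    qed
  qed
  ultimately show ?thesis using lf by (simp add: n_ladder_def)
qed

lemma not_maximal_if_cofinal_ladder:
  assumes n: "1 \<le> n" and L: "n_ladder n (L :: ('a, 'm) gorder_scheme)"
    and C: "meet_subsemilattice C L" and cof: "cofinal_in C L"
    and CI: "n_ladder (n - 1) (L\<lparr>carrier := C\<rparr>)"
  shows "\<not> maximal_ladder TYPE('a \<times> bool) n L"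
proof -
  let ?M = "two_layers L C"
  let ?I = "carrier L \<times> {False}"
  have M: "n_ladder n ?M" by (rule n_ladder_two_layers[OF assms])
  interpret L: lattice L by (rule ladder_lattice[OF L])
  interpret M: lattice ?M by (rule ladder_lattice[OF M])
  obtain c where c: "c \<in> C" "c \<in> carrier L"
    using C unfolding meet_subsemilattice_def by blast
  have IM: "?I \<subseteq> carrier ?M" by (auto simp: two_layers_def)
  have "\<exists>z \<in> carrier L. x \<sqsubseteq>\<^bsub>L\<^esub> z \<and> y \<sqsubseteq>\<^bsub>L\<^esub> z" if "x \<in> carrier L" "y \<in> carrier L" for x y
    using that L.join_left L.join_right L.join_closed by blast
  then have "order_ideal ?I ?M"
    using c(2) by (auto simp: order_ideal_def two_layers_def)
  moreover have "?I \<noteq> carrier ?M" using c(1) by (auto simp: two_layers_def)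
  moreover have "order_isomorphic L (?M\<lparr>carrier := ?I\<rparr>)"
    unfolding order_isomorphic_def
  proof (intro exI conjI)
    show "bij_betw (\<lambda>x. (x, False)) (carrier L) (carrier (?M\<lparr>carrier := ?I\<rparr>))"
      by (auto simp: bij_betw_def inj_on_def)
    have "weak_partial_order (?M\<lparr>carrier := ?I\<rparr>)"
      by (rule weak_partial_order_subset[OF M.weak_partial_order_axioms IM])
    then show "order_emb L (?M\<lparr>carrier := ?I\<rparr>) (\<lambda>x. (x, False))"
      using L.weak_partial_order_axioms by (simp add: order_emb_def two_layers_def)
  qed
  ultimately show ?thesis using M unfolding maximal_ladder_def by blast
qed

section \<open>Maximal ladders\<close>

theorem theorem2p9:
  fixes L :: "'a gorder" and n :: nat
  assumes "1 < n" and "n_ladder n L"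
    and "infinite (UNIV :: 'b set)" and "carrier L \<lesssim> (UNIV :: 'b set)"
  shows "maximal_ladder TYPE('b) n L \<longleftrightarrow>
    \<not> (\<exists>C. meet_subsemilattice C L \<and> cofinal_in C L \<and> n_ladder (n - 1) (L\<lparr>carrier := C\<rparr>))"
proof
  assume "maximal_ladder TYPE('b) n L"
  \<comment> \<open>The two-layer extension lives on pairs, so maximality has to be moved to that type.\<close>
  then have "maximal_ladder TYPE('a \<times> bool) n L"
    by (rule maximal_ladder_any_type[OF assms(3,4)])
  then show "\<not> (\<exists>C. meet_subsemilattice C L \<and> cofinal_in C L \<and> n_ladder (n - 1) (L\<lparr>carrier := C\<rparr>))"
    using not_maximal_if_cofinal_ladder[OF _ assms(2)] assms(1) by auto
next
  assume none: "\<not> (\<exists>C. meet_subsemilattice C L \<and> cofinal_in C L \<and> n_ladder (n - 1) (L\<lparr>carrier := C\<rparr>))"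
  show "maximal_ladder TYPE('b) n L"
  proof (rule ccontr)
    assume "\<not> maximal_ladder TYPE('b) n L"
    then obtain M :: "'b gorder" and I f where M: "n_ladder n M" and I: "order_ideal I M"
      and ne: "I \<noteq> carrier M" and f: "bij_betw f (carrier L) I"
      and emb: "order_emb L (M\<lparr>carrier := I\<rparr>) f"
      using assms(2) by (auto simp: maximal_ladder_def order_isomorphic_def)
    have im: "f ` carrier L = I" and inj: "inj_on f (carrier L)" using f by (auto simp: bij_betw_def)
    obtain p where "p \<in> carrier M" "p \<notin> f ` carrier L"
      using I ne im by (auto simp: order_ideal_def)
    moreover have "f x \<sqsubseteq>\<^bsub>M\<^esub> f y \<longleftrightarrow> x \<sqsubseteq>\<^bsub>L\<^esub> y" if "x \<in> carrier L" "y \<in> carrier L" for x y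
      using emb that by (simp add: order_emb_def)
    ultimately show False
      using ladder_of_shadows[OF M assms(2) I[folded im] inj] none by blast
  qed
qed

end
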